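(* Let $X$ be a finite-dimensional real Hilbert space and let $C$ be a nonempty closed convex subset of $X$ of co-dimension $1$, i.e., $\operatorname{codim} C := \operatorname{codim}(\operatorname{aff} C - \operatorname{aff} C) = 1$. Let $(x_n)_{n\in\mathbb{N}}$ be a sequence in $X$ that is Fejér monotone with respect to $C$ and asymptotically regular, i.e., $x_n - x_{n+1} \to 0$. Then $(x_n)_{n\in\mathbb{N}}$ is convergent.
   Context: A sequence $(x_n)_{n\in\mathbb{N}}$ in $X$ is Fejér monotone with respect to a nonempty set $C\subseteq X$ if $\|x_{n+1}-c\|\le\|x_n-c\|$ for all $c\in C$ and all $n\in\mathbb{N}$. Here $\operatorname{aff} C$ is the affine hull of $C$, so that $\operatorname{aff} C-\operatorname{aff} C$ is the linear subspace parallel to $\operatorname{aff} C$, and its codimension is $\dim X-\dim(\operatorname{aff} C-\operatorname{aff} C)$. *)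

theory Defs
  imports "HOL-Analysis.Analysis"
begin

definition fejer_monotone :: "(nat \<Rightarrow> 'a::real_normed_vector) \<Rightarrow> 'a set \<Rightarrow> bool" where
  "fejer_monotone x C \<longleftrightarrow> C \<noteq> {} \<and> (\<forall>c\<in>C. \<forall>n. norm (x (Suc n) - c) \<le> norm (x n - c))"

definition asymptotically_regular :: "(nat \<Rightarrow> 'a::real_normed_vector) \<Rightarrow> bool" where
  "asymptotically_regular x \<longleftrightarrow> (\<lambda>n. x n - x (Suc n)) \<longlonglongrightarrow> 0"

text \<open>
  \<open>aff C - aff C\<close> is a Minkowski difference; \<open>-\<close> on type \<open>set\<close> is the set-theoretic one,
  hence the comprehension. The subtraction of dimensions on \<^typ>\<open>nat\<close> does not truncate,
  since \<open>dim S \<le> DIM('a)\<close> for every \<open>S :: 'a set\<close>.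
\<close>

definition parallel_subspace :: "'a::real_vector set \<Rightarrow> 'a set" where
  "parallel_subspace C = {u - v |u v. u \<in> affine hull C \<and> v \<in> affine hull C}"

definition codim :: "'a::euclidean_space set \<Rightarrow> nat" where
  "codim C = DIM('a) - dim (parallel_subspace C)"

end

theory Submission
  imports Defs
begin

text \<open>
  For every \<open>c \<in> C\<close> the distances from \<open>x n\<close> to \<open>c\<close> decrease, hence converge. Polarisation then makes
  the inner products of \<open>x n\<close> with \<open>c - d\<close> converge for all \<open>c, d \<in> C\<close>, and by linearity with every
  vector of the hyperplane parallel to the affine hull of \<open>C\<close>. Thus the projection of \<open>x n - c\<close> onto
  this hyperplane converges, and by Pythagoras so does the absolute value of the remaining
  normal coordinate. Asymptotic regularity prevents that coordinate from changing sign infinitely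
  often, unless it tends to 0.
\<close>

text \<open>If the limit \<open>r\<close> of the absolute values is positive, \<open>t\<close>
  eventually stays away from 0 while its increments become small. Its sign is then eventually
  constant, and \<open>t\<close> is this sign times a convergent sequence.\<close>

lemma convergent_if_convergent_abs_if_diff_tendsto_0:
  fixes t :: "nat \<Rightarrow> real"
  assumes "convergent (\<lambda>n. \<bar>t n\<bar>)" and diff: "(\<lambda>n. t n - t (Suc n)) \<longlonglongrightarrow> 0"
  shows "convergent t"
proof -
  obtain r where r: "(\<lambda>n. \<bar>t n\<bar>) \<longlonglongrightarrow> r"
    using assms(1) by (auto simp: convergent_def)
  then have "r \<ge> 0"
    by (rule LIMSEQ_le_const) auto
  show ?thesis
  proof (cases "r = 0")
    case True
    then show ?thesis
      using r by (metis convergent_def tendsto_rabs_zero_iff)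
  next
    case False
    with \<open>r \<ge> 0\<close> have "r > 0" by simp
    have "\<forall>\<^sub>F n in sequentially. \<bar>t n\<bar> > r / 2"
      using r \<open>r > 0\<close> by (intro order_tendstoD) auto
    moreover have "\<forall>\<^sub>F n in sequentially. \<bar>t n - t (Suc n)\<bar> < r"
      using order_tendstoD(2)[OF tendsto_rabs[OF diff]] \<open>r > 0\<close> by simp
    ultimately obtain N where N: "\<And>n. n \<ge> N \<Longrightarrow> \<bar>t n\<bar> > r / 2 \<and> \<bar>t n - t (Suc n)\<bar> < r"
      unfolding eventually_sequentially by (meson le_trans nat_le_linear)
    have sgn: "sgn (t n) = sgn (t N)" if "n \<ge> N" for n
      using that
    proof (induction n rule: dec_induct)
      case (step n)
      \<comment> \<open>Opposite signs would put the two values more than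
        \<open>r / 2 + r / 2\<close> apart, against the bound \<open>r\<close> on the
        increment.\<close>
      have "sgn (t (Suc n)) = sgn (t n)"
        using N[of n] N[of "Suc n"] step.hyps by (auto simp: sgn_if abs_if split: if_splits)
      with step.IH show ?case by simp
    qed simp
    have "(\<lambda>n. sgn (t N) * \<bar>t n\<bar>) \<longlonglongrightarrow> sgn (t N) * r"
      by (intro tendsto_intros r)
    moreover have "\<forall>\<^sub>F n in sequentially. sgn (t N) * \<bar>t n\<bar> = t n"
      using eventually_ge_at_top[of N] by eventually_elim (metis sgn sgn_mult_abs)
    ultimately show ?thesis
      unfolding convergent_def by (metis tendsto_cong)
  qed
qed

lemma convergent_componentwise:
  fixes x :: "nat \<Rightarrow> 'a::euclidean_space"
  assumes "\<And>b. b \<in> Basis \<Longrightarrow> convergent (\<lambda>n. x n \<bullet> b)"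
  shows "convergent x"
proof -
  have "convergent (\<lambda>n. \<Sum>b\<in>Basis. (x n \<bullet> b) *\<^sub>R b)"
    by (intro convergent_sum) (use assms in \<open>force simp: convergent_def intro: tendsto_intros\<close>)
  then show ?thesis
    by (simp add: euclidean_representation)
qed

lemma subspace_convergent_inner:
  "subspace {v::'a::real_inner. convergent (\<lambda>n. x n \<bullet> v)}"
  by (auto simp: subspace_def inner_add_right convergent_const
      intro: convergent_add convergent_mult)

text \<open>For any \<open>c0\<close> in \<open>C\<close> the translate of \<open>S\<close> by
  \<open>c0\<close> is affine and contains \<open>C\<close>, hence also the affine hull. So linear
  properties need checking only on differences of points of \<open>C\<close>.\<close>

lemma parallel_subspace_subset:
  assumes "subspace S" and "\<And>c d. c \<in> C \<Longrightarrow> d \<in> C \<Longrightarrow> c - d \<in> S"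
  shows "parallel_subspace C \<subseteq> S"
proof (cases "C = {}")
  case False
  then obtain c0 where "c0 \<in> C" by auto
  have "affine hull C \<subseteq> (+) c0 ` S"
  proof (rule hull_minimal)
    show "C \<subseteq> (+) c0 ` S"
    proof
      fix c assume "c \<in> C"
      then show "c \<in> (+) c0 ` S"
        using assms(2)[OF _ \<open>c0 \<in> C\<close>] by (intro image_eqI[of _ _ "c - c0"]) auto
    qed
    show "affine ((+) c0 ` S)"
      using assms(1) by (metis affine_translation subspace_imp_affine)
  qed
  then have "u - c0 \<in> S" if "u \<in> affine hull C" for u
    using that by auto
  then have "(u - c0) - (v - c0) \<in> S" if "u \<in> affine hull C" "v \<in> affine hull C" for u v
    using that assms(1) by (blast intro: subspace_diff)
  then show ?thesis
    by (auto simp: parallel_subspace_def)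
qed (simp add: parallel_subspace_def)

lemma fejer_monotone_convergent_norm:
  assumes "fejer_monotone x C" and "c \<in> C"
  shows "convergent (\<lambda>n. norm (x n - c))"
proof -
  have "decseq (\<lambda>n. norm (x n - c))"
    using assms by (intro decseq_SucI) (auto simp: fejer_monotone_def)
  then obtain L where "(\<lambda>n. norm (x n - c)) \<longlonglongrightarrow> L"
    using decseq_convergent[of _ 0] norm_ge_zero by metis
  then show ?thesis by (auto simp: convergent_def)
qed

text \<open>Expanding the squared distances from \<open>x n\<close> to \<open>c\<close> and to
  \<open>d\<close> cancels the square of \<open>x n\<close> and leaves an expression for the inner
  product with \<open>c - d\<close> in terms of convergent sequences. The admissible
  \<open>v\<close> form a subspace.\<close>

lemma fejer_monotone_convergent_inner:
  fixes C :: "'a::real_inner set"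
  assumes "fejer_monotone x C" and "v \<in> span (parallel_subspace C)"
  shows "convergent (\<lambda>n. x n \<bullet> v)"
proof -
  let ?S = "{v. convergent (\<lambda>n. x n \<bullet> v)}"
  have "c - d \<in> ?S" if c: "c \<in> C" and d: "d \<in> C" for c d
  proof -
    obtain L M where "(\<lambda>n. norm (x n - c)) \<longlonglongrightarrow> L" "(\<lambda>n. norm (x n - d)) \<longlonglongrightarrow> M"
      using fejer_monotone_convergent_norm[OF assms(1)] c d by (meson convergent_def)
    then have "(\<lambda>n. ((norm (x n - d))\<^sup>2 - (norm (x n - c))\<^sup>2 - d \<bullet> d + c \<bullet> c) / 2)
        \<longlonglongrightarrow> (M\<^sup>2 - L\<^sup>2 - d \<bullet> d + c \<bullet> c) / 2"
      by (intro tendsto_intros) auto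
    moreover have "((norm (x n - d))\<^sup>2 - (norm (x n - c))\<^sup>2 - d \<bullet> d + c \<bullet> c) / 2 = x n \<bullet> (c - d)" for n
      by (simp add: power2_norm_eq_inner inner_diff inner_commute field_simps)
    ultimately show ?thesis by (auto simp: convergent_def)
  qed
  then have "span (parallel_subspace C) \<subseteq> ?S"
    by (intro span_minimal parallel_subspace_subset subspace_convergent_inner)
  with assms(2) show ?thesis by auto
qed

theorem theorem2p8:
  fixes C :: "'a::euclidean_space set" and x :: "nat \<Rightarrow> 'a"
  assumes "C \<noteq> {}" and "closed C" and "convex C"
    and "codim C = 1"
    and "fejer_monotone x C"
    and "asymptotically_regular x"
  shows "convergent x"
proof -
  obtain c where c: "c \<in> C" using assms(1) by auto
  have "dim (parallel_subspace C) = DIM('a) - 1"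
    using assms(4) unfolding codim_def by linarith
  \<comment> \<open>Codimension 1 enters here: \<open>a\<close> is a normal vector, unique up to
    scaling, and \<open>e\<close> below is its unit version.\<close>
  then obtain a :: 'a where "a \<noteq> 0" and a: "span (parallel_subspace C) = {v. a \<bullet> v = 0}"
    using dim_eq_hyperplane by blast
  define e where "e = sgn a"
  have e: "e \<bullet> e = 1"
    using \<open>a \<noteq> 0\<close> by (simp add: e_def norm_sgn flip: power2_norm_eq_inner)
  define y where "y n = x n - c" for n
  define t where "t n = y n \<bullet> e" for n
  define p where "p n = y n - t n *\<^sub>R e" for n
  have "convergent (\<lambda>n. p n \<bullet> b)" for b
  proof -
    \<comment> \<open>Orthogonal projection is self-adjoint: pairing \<open>p n\<close> with
      \<open>b\<close> amounts to pairing \<open>y n\<close> with the projection of \<open>b\<close>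
      onto the hyperplane, where convergence is known.\<close>
    have "a \<bullet> (b - (e \<bullet> b) *\<^sub>R e) = norm a * (e \<bullet> (b - (e \<bullet> b) *\<^sub>R e))"
      using \<open>a \<noteq> 0\<close> by (simp add: e_def sgn_div_norm)
    also have "\<dots> = 0"
      by (simp add: inner_diff_right e)
    finally have "convergent (\<lambda>n. x n \<bullet> (b - (e \<bullet> b) *\<^sub>R e))"
      using fejer_monotone_convergent_inner[OF assms(5)] a by blast
    then have "convergent (\<lambda>n. x n \<bullet> (b - (e \<bullet> b) *\<^sub>R e) - c \<bullet> (b - (e \<bullet> b) *\<^sub>R e))"
      by (intro convergent_diff convergent_const)
    moreover have "x n \<bullet> (b - (e \<bullet> b) *\<^sub>R e) - c \<bullet> (b - (e \<bullet> b) *\<^sub>R e) = p n \<bullet> b" for n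
      by (simp add: p_def t_def y_def inner_diff algebra_simps)
    ultimately show ?thesis by simp
  qed
  then have "convergent p"
    by (rule convergent_componentwise)
  then obtain P where P: "p \<longlonglongrightarrow> P"
    by (auto simp: convergent_def)
  obtain L where L: "(\<lambda>n. norm (y n)) \<longlonglongrightarrow> L"
    using fejer_monotone_convergent_norm[OF assms(5) c] by (auto simp: convergent_def y_def)
  \<comment> \<open>By Pythagoras the radicand is the square of \<open>t n\<close>, so the root is
    its absolute value; the sign is still undetermined.\<close>
  have "(\<lambda>n. sqrt ((norm (y n))\<^sup>2 - (norm (p n))\<^sup>2)) \<longlonglongrightarrow> sqrt (L\<^sup>2 - (norm P)\<^sup>2)"
    by (intro tendsto_intros L P)
  moreover have "(norm (y n))\<^sup>2 - (norm (p n))\<^sup>2 = (t n)\<^sup>2" for n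
    unfolding power2_norm_eq_inner p_def t_def
    by (simp add: inner_diff inner_commute e power2_eq_square)
  ultimately have "convergent (\<lambda>n. \<bar>t n\<bar>)"
    by (auto simp: convergent_def)
  moreover have "(\<lambda>n. t n - t (Suc n)) \<longlonglongrightarrow> 0"
  proof -
    \<comment> \<open>The base point \<open>c\<close> cancels in consecutive differences of
      \<open>t\<close>.\<close>
    have "(\<lambda>n. (x n - x (Suc n)) \<bullet> e) \<longlonglongrightarrow> 0 \<bullet> e"
      using assms(6) unfolding asymptotically_regular_def by (intro tendsto_intros)
    then show ?thesis
      by (simp add: t_def y_def inner_diff_left)
  qed
  ultimately have "convergent t"
    by (rule convergent_if_convergent_abs_if_diff_tendsto_0)
  then obtain T where "t \<longlonglongrightarrow> T"
    by (auto simp: convergent_def)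
  then have "(\<lambda>n. p n + t n *\<^sub>R e + c) \<longlonglongrightarrow> P + T *\<^sub>R e + c"
    by (intro tendsto_intros P)
  then show ?thesis
    by (auto simp: convergent_def p_def y_def)
qed

end
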